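(* Let $H$ be a real inner product space. Then the norm function $f(x)=\|x\|$, $x\in H$, is strongly quasiconvex on any nonempty bounded convex subset $\Omega$ of $H$.
   Context: Spaces are nontrivial. A function $f$ is strongly quasiconvex on a nonempty convex set $\Omega$ if there exists $\sigma>0$ such that $f(\lambda x+(1-\lambda)y)\le\max\{f(x),f(y)\}-\frac{\sigma}{2}\lambda(1-\lambda)\|x-y\|^2$ for all $x,y\in\Omega$ and $0<\lambda<1$. The norm is the one induced by the inner product. *)

theory Defs
  imports "HOL-Analysis.Analysis"
begin

(* As in the library's convex_on, the standing requirements on the domain are part of the
   predicate. *)
definition strongly_quasiconvex_on ::
    "'a::real_normed_vector set \<Rightarrow> ('a \<Rightarrow> real) \<Rightarrow> bool" where
  "strongly_quasiconvex_on \<Omega> f \<longleftrightarrow>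
     \<Omega> \<noteq> {} \<and> convex \<Omega> \<and>
     (\<exists>\<sigma>>0. \<forall>x\<in>\<Omega>. \<forall>y\<in>\<Omega>. \<forall>l. 0 < l \<and> l < 1 \<longrightarrow>
        f (l *\<^sub>R x + (1 - l) *\<^sub>R y)
          \<le> max (f x) (f y) - \<sigma> / 2 * l * (1 - l) * (norm (x - y))\<^sup>2)"

end

(* On a set where norms are at most B, the identity
   |l x + (1-l) y|^2 = l |x|^2 + (1-l) |y|^2 - l (1-l) |x - y|^2 makes the squared norm strongly
   convex, and factoring M^2 - z^2 = (M - z) (M + z) with M + z \<le> 2 B passes from squares to
   norms, so sigma = 1/B works. *)
theory Submission
  imports Defs
begin

text \<open>Compare coefficients after expanding inner products: l^2 = l - l (1 - l), likewise with
  1 - l for l, and the cross term is 2 l (1 - l) <x, y> on both sides.\<close>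

lemma norm_convex_combination_square:
  fixes x y :: "'a::real_inner" and l :: real
  shows "(norm (l *\<^sub>R x + (1 - l) *\<^sub>R y))\<^sup>2
    = l * (norm x)\<^sup>2 + (1 - l) * (norm y)\<^sup>2 - l * (1 - l) * (norm (x - y))\<^sup>2"
  by (simp add: power2_norm_eq_inner inner_add inner_diff inner_commute[of y x])
    (simp add: algebra_simps)

lemma norm_convex_combination_le:
  fixes x y :: "'a::real_inner" and l B :: real
  assumes "0 < B" "norm x \<le> B" "norm y \<le> B" "0 \<le> l" "l \<le> 1"
  shows "norm (l *\<^sub>R x + (1 - l) *\<^sub>R y)
    \<le> max (norm x) (norm y) - (1 / B) / 2 * l * (1 - l) * (norm (x - y))\<^sup>2"
proof -
  define M where "M = max (norm x) (norm y)"
  define z where "z = norm (l *\<^sub>R x + (1 - l) *\<^sub>R y)"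
  define d where "d = l * (1 - l) * (norm (x - y))\<^sup>2"
  have M: "0 \<le> M" "M \<le> B" "norm x \<le> M" "norm y \<le> M"
    using assms by (auto simp: M_def le_max_iff_disj)
  have "l * (norm x)\<^sup>2 + (1 - l) * (norm y)\<^sup>2 \<le> M\<^sup>2"
    using assms M by (intro convex_bound_le power_mono) auto
  then have sq: "z\<^sup>2 \<le> M\<^sup>2 - d"
    by (simp add: z_def d_def norm_convex_combination_square)
  \<comment> \<open>The sign of \<open>d\<close> yields \<open>z \<le> M\<close>, so that
    multiplying by \<open>M - z\<close> preserves inequalities below.\<close>
  have "0 \<le> d"
    using assms by (simp add: d_def)
  with sq have "z\<^sup>2 \<le> M\<^sup>2"
    by linarith
  then have "z \<le> M"
    using M(1) by (rule power2_le_imp_le)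
  have "d \<le> (M - z) * (M + z)"
    using sq by (simp add: power2_eq_square algebra_simps)
  \<comment> \<open>Here z \<le> M \<le> B bounds the second factor.\<close>
  also have "\<dots> \<le> (M - z) * (2 * B)"
    using \<open>z \<le> M\<close> M(2) by (intro mult_left_mono) auto
  \<comment> \<open>The quotient is (1/B)/2 * d, which is where sigma = 1/B comes from.\<close>
  finally have "d / (2 * B) \<le> M - z"
    using assms(1) by (simp add: divide_le_eq)
  then show ?thesis
    by (simp add: z_def M_def d_def mult.assoc)
qed

theorem proposition3p1:
  fixes \<Omega> :: "'a::real_inner set"
  assumes nontrivial: "\<exists>x::'a. x \<noteq> 0"
    and "\<Omega> \<noteq> {}" and "bounded \<Omega>" and "convex \<Omega>"
  shows "strongly_quasiconvex_on \<Omega> (\<lambda>x. norm x)"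
proof -
  \<comment> \<open>A strictly positive bound exists even for \<Omega> = {0}, so 1/B is a positive
    constant independent of the points.\<close>
  obtain B where B: "0 < B" "\<And>x. x \<in> \<Omega> \<Longrightarrow> norm x \<le> B"
    using \<open>bounded \<Omega>\<close> by (auto simp: bounded_pos)
  then have "norm (l *\<^sub>R x + (1 - l) *\<^sub>R y)
      \<le> max (norm x) (norm y) - (1 / B) / 2 * l * (1 - l) * (norm (x - y))\<^sup>2"
    if "x \<in> \<Omega>" "y \<in> \<Omega>" "0 < l" "l < 1" for x y l
    using that by (intro norm_convex_combination_le) auto
  moreover have "0 < 1 / B"
    using B(1) by simp
  ultimately show ?thesis
    unfolding strongly_quasiconvex_on_def using assms(2,4) by (intro conjI exI[of _ "1/B"]) auto
qed

end
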